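(* Let $(X,d)$ be a finite ultrametric space with $|X|\geqslant 3$, and let $(G_X,w_d)$ be the complete weighted graph with vertex set $X$ and weights $w_d(\{x,y\})=d(x,y)$ for distinct $x,y\in X$. Then the following conditions are equivalent. (i) $(X,d)\in\mathfrak{U}$, i.e. $|\operatorname{Sp}(X)|=|X|$. (ii) There exists a characteristic Hamiltonian path in $G_X$ (with the weight $w_d$). (iii) There exists a characteristic Hamiltonian cycle in $G_X$ (with the weight $w_d$).
   Context: An ultrametric on a set $X$ is a function $d\colon X\times X\to[0,\infty)$ such that $d(x,y)=d(y,x)$, $d(x,y)=0\Leftrightarrow x=y$, and $d(x,y)\leqslant\max\{d(x,z),d(z,y)\}$ for all $x,y,z\in X$. The spectrum is $\operatorname{Sp}(X)=\{d(x,y)\colon x,y\in X\}$ (it contains $0$ if $X\ne\varnothing$). $\mathfrak{U}$ is the class of finite ultrametric spaces $X$ with $|\operatorname{Sp}(X)|=|X|$. Graphs are simple and undirected. A path is a nonempty graph with vertex set $\{x_0,\dots,x_k\}$ (the $x_i$ all distinct) and edge set $\{\{x_0,x_1\},\dots,\{x_{k-1},x_k\}\}$. A finite graph $C$ is a cycle if $|V(C)|\geqslant 3$ and its vertices can be enumerated as $(v_1,\dots,v_n)$ so that $\{v_i,v_j\}\in E(C)$ iff $|i-j|=1$ or $|i-j|=n-1$. A Hamiltonian path (respectively cycle) in a graph $G$ is a path (respectively cycle) that is a subgraph of $G$ and visits every vertex of $G$ exactly once. A weighted path $(P,w)$, $w\colon E(P)\to[0,\infty)$, is characteristic if $w$ is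 injective and strictly positive. A weighted cycle $(C,w)$, $w\colon E(C)\to[0,\infty)$, is characteristic if: (1) there are exactly two distinct edges $e_1,e_2\in E(C)$ with $w(e_1)=w(e_2)=\max_{e\in E(C)}w(e)$ (i.e. the maximal weight is attained on exactly two edges); and (2) the restriction of $w$ to $E(C)\setminus\{e_1,e_2\}$ is strictly positive and injective. *)

theory Defs
  imports "HOL-Analysis.Analysis"
begin

section \<open>Ultrametric spaces\<close>

locale Ultrametric_space =
  fixes X :: "'a set" and d :: "'a \<Rightarrow> 'a \<Rightarrow> real"
  assumes nonneg: "\<lbrakk>x \<in> X; y \<in> X\<rbrakk> \<Longrightarrow> 0 \<le> d x y"
    and commute: "\<lbrakk>x \<in> X; y \<in> X\<rbrakk> \<Longrightarrow> d x y = d y x"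
    and zero: "\<lbrakk>x \<in> X; y \<in> X\<rbrakk> \<Longrightarrow> d x y = 0 \<longleftrightarrow> x = y"
    and ultra: "\<lbrakk>x \<in> X; y \<in> X; z \<in> X\<rbrakk> \<Longrightarrow> d x y \<le> max (d x z) (d z y)"

definition Sp :: "'a set \<Rightarrow> ('a \<Rightarrow> 'a \<Rightarrow> real) \<Rightarrow> real set" where
  "Sp X d = {d x y | x y. x \<in> X \<and> y \<in> X}"

definition in_class_U :: "'a set \<Rightarrow> ('a \<Rightarrow> 'a \<Rightarrow> real) \<Rightarrow> bool" where
  "in_class_U X d \<longleftrightarrow> finite X \<and> Ultrametric_space X d \<and> card (Sp X d) = card X"

section \<open>Simple graphs, paths and cycles\<close>

record 'a graph =
  verts :: "'a set"
  edges :: "'a set set"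

definition simple_graph :: "'a graph \<Rightarrow> bool" where
  "simple_graph G \<longleftrightarrow> edges G \<subseteq> {{x, y} | x y. x \<in> verts G \<and> y \<in> verts G \<and> x \<noteq> y}"

definition subgraph :: "'a graph \<Rightarrow> 'a graph \<Rightarrow> bool" where
  "subgraph H G \<longleftrightarrow> simple_graph H \<and> simple_graph G \<and>
     verts H \<subseteq> verts G \<and> edges H \<subseteq> edges G"

definition complete_graph :: "'a set \<Rightarrow> 'a graph" where
  "complete_graph X = \<lparr>verts = X, edges = {{x, y} | x y. x \<in> X \<and> y \<in> X \<and> x \<noteq> y}\<rparr>"

text \<open>A single vertex counts as a path; the empty graph does not.\<close>

definition is_path :: "'a graph \<Rightarrow> bool" where
  "is_path P \<longleftrightarrow> (\<exists>xs. xs \<noteq> [] \<and> distinct xs \<and> verts P = set xs \<and>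
     edges P = {{xs ! i, xs ! Suc i} | i. Suc i < length xs})"

text \<open>The positions are compared as integers because subtraction of naturals truncates.\<close>

definition is_cycle :: "'a graph \<Rightarrow> bool" where
  "is_cycle C \<longleftrightarrow> simple_graph C \<and> finite (verts C) \<and> 3 \<le> card (verts C) \<and>
     (\<exists>vs. distinct vs \<and> set vs = verts C \<and>
        (\<forall>i < length vs. \<forall>j < length vs.
           {vs ! i, vs ! j} \<in> edges C \<longleftrightarrow>
             \<bar>int i - int j\<bar> = 1 \<or> \<bar>int i - int j\<bar> = int (length vs) - 1))"

text \<open>
  The vertices of a path or cycle are enumerated without repetition, so visiting every vertex of
  \<open>G\<close> exactly once amounts to having the same vertex set as \<open>G\<close>.
\<close>

definition hamiltonian_path :: "'a graph \<Rightarrow> 'a graph \<Rightarrow> bool" where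
  "hamiltonian_path G P \<longleftrightarrow> is_path P \<and> subgraph P G \<and> verts P = verts G"

definition hamiltonian_cycle :: "'a graph \<Rightarrow> 'a graph \<Rightarrow> bool" where
  "hamiltonian_cycle G C \<longleftrightarrow> is_cycle C \<and> subgraph C G \<and> verts C = verts G"

section \<open>Characteristic weighted paths and cycles\<close>

text \<open>Weights are total functions on vertex sets; only their values on edges are relevant.\<close>

definition characteristic_path :: "'a graph \<Rightarrow> ('a set \<Rightarrow> real) \<Rightarrow> bool" where
  "characteristic_path P w \<longleftrightarrow> is_path P \<and> (\<forall>e \<in> edges P. 0 \<le> w e) \<and>
     inj_on w (edges P) \<and> (\<forall>e \<in> edges P. 0 < w e)"

definition characteristic_cycle :: "'a graph \<Rightarrow> ('a set \<Rightarrow> real) \<Rightarrow> bool" where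
  "characteristic_cycle C w \<longleftrightarrow> is_cycle C \<and> (\<forall>e \<in> edges C. 0 \<le> w e) \<and>
     (\<exists>e1 e2. e1 \<noteq> e2 \<and>
        {e \<in> edges C. w e = Max (w ` edges C)} = {e1, e2} \<and>
        (\<forall>e \<in> edges C - {e1, e2}. 0 < w e) \<and>
        inj_on w (edges C - {e1, e2}))"

text \<open>
  The weight of an edge does not depend on the order of its endpoints when \<open>d\<close> is symmetric on
  them, see \<open>edge_weight_eq\<close> below; the value is unspecified on sets that are not edges.
\<close>

definition edge_weight :: "('a \<Rightarrow> 'a \<Rightarrow> real) \<Rightarrow> 'a set \<Rightarrow> real" where
  "edge_weight d e = (THE r. \<exists>x y. x \<noteq> y \<and> e = {x, y} \<and> r = d x y)"

lemma (in Ultrametric_space) edge_weight_eq: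
  assumes "x \<in> X" "y \<in> X" "x \<noteq> y"
  shows "edge_weight d {x, y} = d x y"
  unfolding edge_weight_def
proof (rule the_equality)
  show "\<exists>u v. u \<noteq> v \<and> {x, y} = {u, v} \<and> d x y = d u v"
    using assms(3) by blast
next
  fix r
  assume "\<exists>u v. u \<noteq> v \<and> {x, y} = {u, v} \<and> r = d u v"
  then show "r = d x y"
    using commute[OF assms(1,2)] by (auto simp: doubleton_eq_iff)
qed

end

theory Submission
  imports Defs
begin

text \<open>
  Let \<open>a\<close>, \<open>b\<close> be two points at minimal positive distance. Every other point is equidistant from
  them, so deleting \<open>b\<close> removes at most the value \<open>d a b\<close> from the spectrum. By induction the
  spectrum has at most \<open>card X\<close> elements. In the extremal case the smaller space is again extremal and
  misses the value \<open>d a b\<close>, so inserting \<open>b\<close> right after \<open>a\<close> in a Hamiltonian path of the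
  smaller space only adds one new weight to it. Closing up a path with pairwise distinct
  weights gives a cycle in which, by the ultrametric inequality, the closing edge has the maximal
  weight of the path. Conversely, a characteristic path or cycle has \<open>card X - 1\<close> distinct
  positive weights, which together with \<open>0\<close> make the spectrum as large as possible.
\<close>

section \<open>Consecutive values of a function along a list\<close>

fun steps :: "('a \<Rightarrow> 'a \<Rightarrow> 'b) \<Rightarrow> 'a list \<Rightarrow> 'b list" where
  "steps f (x # y # zs) = f x y # steps f (y # zs)"
| "steps f _ = []"

lemma length_steps [simp]: "length (steps f xs) = length xs - 1"
  by (induction f xs rule: steps.induct) auto

lemma nth_steps: "Suc i < length xs \<Longrightarrow> steps f xs ! i = f (xs ! i) (xs ! Suc i)"
proof (induction f xs arbitrary: i rule: steps.induct)
  case (1 f x y zs)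
  then show ?case by (cases i) auto
qed auto

lemma steps_Cons: "xs \<noteq> [] \<Longrightarrow> steps f (x # xs) = f x (hd xs) # steps f xs"
  by (cases xs) auto

text \<open>The point \<open>a\<close> closes the first part and opens the second, so no step is
  lost at the cut.\<close>

lemma steps_append: "steps f (us @ a # vs) = steps f (us @ [a]) @ steps f (a # vs)"
  by (induction f us rule: steps.induct) (auto split: list.split)

lemma steps_append_edge:
  "steps f (us @ a # b # vs) = steps f (us @ [a]) @ f a b # steps f (b # vs)"
  by (subst steps_append) simp

section \<open>Distances in an ultrametric space\<close>

context Ultrametric_space
begin

lemma subspace: "Y \<subseteq> X \<Longrightarrow> Ultrametric_space Y d"
  by unfold_locales (auto intro: nonneg commute ultra simp: zero subset_iff)

lemma self_zero: "x \<in> X \<Longrightarrow> d x x = 0"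
  using zero by blast

lemma pos: "x \<in> X \<Longrightarrow> y \<in> X \<Longrightarrow> x \<noteq> y \<Longrightarrow> 0 < d x y"
  using nonneg[of x y] zero[of x y] by fastforce

lemma finite_Sp: "finite X \<Longrightarrow> finite (Sp X d)"
  by (rule finite_subset[of _ "(\<lambda>(x, y). d x y) ` (X \<times> X)"]) (auto simp: Sp_def)

text \<open>For \<open>d a b\<close> minimal among positive distances, the ultrametric inequality
  through \<open>a\<close> or \<open>b\<close> bounds each of \<open>d a z\<close> and
  \<open>d b z\<close> by the other. Hence replacing \<open>b\<close> by \<open>a\<close> preserves
  every distance except the one between \<open>a\<close> and \<open>b\<close>.\<close>

lemma minimal_pair:
  assumes "finite X" "2 \<le> card X"
  obtains a b where "a \<in> X" "b \<in> X" "a \<noteq> b"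
    "\<And>z. z \<in> X \<Longrightarrow> z \<noteq> a \<Longrightarrow> z \<noteq> b \<Longrightarrow> d b z = d a z"
    "Sp X d = insert (d a b) (Sp (X - {b}) d)"
proof -
  define S where "S = {(x, y). x \<in> X \<and> y \<in> X \<and> x \<noteq> y}"
  have "finite S"
    by (rule finite_subset[of _ "X \<times> X"]) (auto simp: S_def assms)
  moreover have "S \<noteq> {}"
  proof -
    obtain x y where "x \<in> X" "y \<in> X" "x \<noteq> y"
      using assms card_le_Suc0_iff_eq[of X] by fastforce
    then show ?thesis by (auto simp: S_def)
  qed
  ultimately obtain p where "p \<in> S" "\<forall>q \<in> S. case_prod d p \<le> case_prod d q"
    using ex_is_arg_min_if_finite[of S "case_prod d"] unfolding is_arg_min_linorder by blast
  then obtain a b where ab: "a \<in> X" "b \<in> X" "a \<noteq> b"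
    and min: "\<And>x y. x \<in> X \<Longrightarrow> y \<in> X \<Longrightarrow> x \<noteq> y \<Longrightarrow> d a b \<le> d x y"
    by (cases p) (auto simp: S_def)
  have eq: "d b z = d a z" if "z \<in> X" "z \<noteq> a" "z \<noteq> b" for z
    using ultra[of b z a] ultra[of a z b] min[of a z] min[of b z] commute[of a b] ab that
    by (auto simp: max_def split: if_splits)
  then have eq': "d z b = d z a" if "z \<in> X" "z \<noteq> a" "z \<noteq> b" for z
    using that ab commute by metis
  have "d x y \<in> insert (d a b) (Sp (X - {b}) d)" if "x \<in> X" "y \<in> X" for x y
  proof (cases "{x, y} = {a, b}")
    case True
    then show ?thesis
      using commute[of a b] ab by (auto simp: doubleton_eq_iff)
  next
    case False
    \<comment> \<open>The retraction of \<open>X\<close> onto \<open>X - {b}\<close> that sends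
      \<open>b\<close> to \<open>a\<close>; it realizes the value \<open>d x y\<close> without using
      \<open>b\<close>.\<close>
    define r where "r z = (if z = b then a else z)" for z
    have "d x y = d (r x) (r y)"
      using False eq eq' that ab by (auto simp: r_def self_zero)
    moreover have "r x \<in> X - {b}" "r y \<in> X - {b}"
      using that ab by (auto simp: r_def)
    ultimately show ?thesis unfolding Sp_def by blast
  qed
  then have "Sp X d = insert (d a b) (Sp (X - {b}) d)"
    using ab unfolding Sp_def by blast
  with ab eq show ?thesis using that by blast
qed

lemma set_steps_subset_Sp: "set xs \<subseteq> X \<Longrightarrow> set (steps d xs) \<subseteq> Sp X d"
  by (induction d xs rule: steps.induct) (auto simp: Sp_def)

text \<open>The ultrametric inequality is iterated along the list. A one-point list has end distance
  0, which is where \<open>0 < c\<close> enters.\<close>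

lemma endpoints_less:
  assumes "xs \<noteq> []" "set xs \<subseteq> X" "\<forall>s \<in> set (steps d xs). s < c" "0 < c"
  shows "d (hd xs) (last xs) < c"
  using assms
proof (induction xs rule: list_nonempty_induct)
  case (cons x xs)
  have "d (hd xs) (last xs) < c"
    using cons by (simp add: steps_Cons)
  moreover have "hd xs \<in> X" "last xs \<in> X"
    using cons.hyps cons.prems(1) by auto
  ultimately show ?case
    using cons.hyps cons.prems ultra[of x "last xs" "hd xs"] by (auto simp: steps_Cons)
qed (auto simp: self_zero)

text \<open>The upper bound is the iterated ultrametric inequality. For the lower bound, the path is
  cut at its unique longest step: each of the two remaining segments has ends closer than that step,
  so a shorter closing distance would make the longest step shorter than itself.\<close>

lemma closing_weight:
  assumes "set xs \<subseteq> X" "i < length (steps d xs)" "distinct (steps d xs)"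
    and max: "\<forall>s \<in> set (steps d xs). s \<le> steps d xs ! i"
    and "0 < steps d xs ! i"
  shows "d (hd xs) (last xs) = steps d xs ! i"
proof (rule antisym)
  let ?M = "steps d xs ! i" and ?D = "d (hd xs) (last xs)"
  have "xs \<noteq> []" using assms(2) by auto
  show "?D \<le> ?M"
  proof (rule ccontr)
    assume "\<not> ?D \<le> ?M"
    \<comment> \<open>With \<open>c\<close> chosen as the closing distance itself,
      \<open>endpoints_less\<close> makes that distance smaller than itself.\<close>
    then have "\<forall>s \<in> set (steps d xs). s < ?D" using max by force
    with \<open>xs \<noteq> []\<close> \<open>\<not> ?D \<le> ?M\<close> show False
      using endpoints_less[of xs ?D] assms by auto
  qed
  define us a b vs where "us = take i xs" and "a = xs ! i" and "b = xs ! Suc i"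
    and "vs = drop (Suc (Suc i)) xs"
  have i: "Suc i < length xs" using assms(2) by auto
  then have xs: "xs = us @ a # b # vs"
    by (simp add: us_def a_def b_def vs_def Cons_nth_drop_Suc id_take_nth_drop)
  have M: "?M = d a b" using nth_steps[OF i] by (simp add: a_def b_def)
  have "distinct (steps d (us @ [a]) @ d a b # steps d (b # vs))"
    using assms(3) unfolding xs steps_append_edge .
  moreover have "\<forall>s \<in> set (steps d (us @ [a]) @ d a b # steps d (b # vs)). s \<le> d a b"
    using max unfolding M unfolding xs steps_append_edge .
  \<comment> \<open>Distinctness of the steps makes the bound strict on both sides of the
    cut.\<close>
  ultimately have less: "\<forall>s \<in> set (steps d (us @ [a])). s < d a b"
      "\<forall>s \<in> set (steps d (b # vs)). s < d a b"
    by (auto simp: less_le)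
  have in_X: "hd (us @ [a]) \<in> X" "last (b # vs) \<in> X" "a \<in> X" "b \<in> X"
    using assms(1) last_in_set[of "b # vs"] unfolding xs
    by (auto simp: hd_append simp del: last.simps)
  have less': "d (hd (us @ [a])) a < d a b" "d b (last (b # vs)) < d a b"
    using endpoints_less[OF _ _ less(1)] endpoints_less[OF _ _ less(2)] assms(1,5) M xs
    by (auto simp del: last.simps)
  show "?M \<le> ?D"
  proof (rule ccontr)
    assume "\<not> ?M \<le> ?D"
    then have "d (hd (us @ [a])) (last (b # vs)) < d a b"
      unfolding M unfolding xs by (cases us) auto
    \<comment> \<open>The chain from \<open>a\<close> to the first point, to the last point, to
      \<open>b\<close> has all three distances below \<open>d a b\<close>; two uses of
      \<open>ultra\<close> give the contradiction.\<close>
    then show False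
      using less' in_X ultra[of a b "hd (us @ [a])"]
        ultra[of "hd (us @ [a])" b "last (b # vs)"]
        commute[of a "hd (us @ [a])"] commute[of b "last (b # vs)"]
      by linarith
  qed
qed

end

section \<open>The bound on the spectrum and its extremal case\<close>

lemma card_Sp_le:
  assumes "Ultrametric_space X d" "finite X" "X \<noteq> {}"
  shows "card (Sp X d) \<le> card X"
  using assms
proof (induction "card X" arbitrary: X rule: less_induct)
  case less
  interpret Ultrametric_space X d by fact
  show ?case
  proof (cases "2 \<le> card X")
    case True
    from minimal_pair[OF less.prems(2) True] obtain a b
      where "a \<in> X" "b \<in> X" "a \<noteq> b" and Sp: "Sp X d = insert (d a b) (Sp (X - {b}) d)"
      by metis
    then have "card (X - {b}) < card X" "X - {b} \<noteq> {}" "card X = Suc (card (X - {b}))"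
      using card_Suc_Diff1[OF less.prems(2) \<open>b \<in> X\<close>] by auto
    with less.hyps[of "X - {b}"] subspace[of "X - {b}"] less.prems Sp show ?thesis
      using card_insert_le_m1[of "card X" "Sp (X - {b}) d" "d a b"] by auto
  next
    case False
    then obtain x where "X = {x}"
      using less.prems card_1_singleton_iff[of X]
      by (metis One_nat_def Suc_1 Suc_leI card_gt_0_iff le_antisym not_less_eq_eq)
    then show ?thesis by (simp add: Sp_def)
  qed
qed

lemma ex_enumeration_distinct_steps:
  assumes "Ultrametric_space X d" "finite X" "X \<noteq> {}" "card (Sp X d) = card X"
  shows "\<exists>xs. distinct xs \<and> set xs = X \<and> distinct (steps d xs)"
  using assms
proof (induction "card X" arbitrary: X rule: less_induct)
  case less
  interpret Ultrametric_space X d by fact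
  show ?case
  proof (cases "2 \<le> card X")
    case True
    from minimal_pair[OF less.prems(2) True] obtain a b
      where ab: "a \<in> X" "b \<in> X" "a \<noteq> b"
        and eq: "\<And>z. z \<in> X \<Longrightarrow> z \<noteq> a \<Longrightarrow> z \<noteq> b \<Longrightarrow> d b z = d a z"
        and Sp: "Sp X d = insert (d a b) (Sp (X - {b}) d)"
      by metis
    let ?Y = "X - {b}"
    have Y: "Ultrametric_space ?Y d" "finite ?Y" "?Y \<noteq> {}" "card X = Suc (card ?Y)"
      using ab less.prems(2) subspace card_Suc_Diff1[OF less.prems(2) \<open>b \<in> X\<close>] by auto
    have le: "card (Sp ?Y d) \<le> card ?Y" using card_Sp_le Y by blast
    have fin: "finite (Sp ?Y d)" using Ultrametric_space.finite_Sp Y by blast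
    \<comment> \<open>Otherwise \<open>Sp X d\<close> would equal \<open>Sp ?Y d\<close> and have at
      most \<open>card X - 1\<close> elements.\<close>
    have new: "d a b \<notin> Sp ?Y d"
      using le less.prems(4) Y(4) Sp by (auto simp: insert_absorb)
    then have "card (Sp ?Y d) = card ?Y"
      using fin less.prems(4) Y(4) Sp by auto
    then obtain xs where xs: "distinct xs" "set xs = ?Y" "distinct (steps d xs)"
      using less.hyps[of ?Y] Y by auto
    then obtain us vs where split: "xs = us @ a # vs"
      using ab split_list[of a xs] by auto
    let ?ys = "us @ a # b # vs"
    \<comment> \<open>The point following \<open>a\<close> in \<open>xs\<close>, if any, is as far
      from \<open>b\<close> as from \<open>a\<close>, so the step that left \<open>a\<close> keeps
      its value when it leaves \<open>b\<close>.\<close>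
    have "steps d (b # vs) = steps d (a # vs)"
      using xs split eq by (cases vs) auto
    then have "steps d ?ys = steps d (us @ [a]) @ d a b # steps d (a # vs)"
      using steps_append_edge[of d us a b vs] by simp
    moreover have "steps d xs = steps d (us @ [a]) @ steps d (a # vs)"
      unfolding split by (rule steps_append)
    \<comment> \<open>All old steps are spectrum values of \<open>?Y\<close>, hence different from
      the inserted value \<open>d a b\<close>.\<close>
    moreover have "set (steps d xs) \<subseteq> Sp ?Y d"
      using Ultrametric_space.set_steps_subset_Sp Y(1) xs by blast
    ultimately have "distinct (steps d ?ys)"
      using xs(3) new by auto
    moreover have "distinct ?ys" "set ?ys = X"
      using xs split ab by auto
    ultimately show ?thesis by blast
  next
    case False
    then obtain x where "X = {x}"
      using less.prems card_1_singleton_iff[of X]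
      by (metis One_nat_def Suc_1 Suc_leI card_gt_0_iff le_antisym not_less_eq_eq)
    then show ?thesis by (intro exI[of _ "[x]"]) auto
  qed
qed

section \<open>Edges of the path along a list, in the form used by \<open>is_path\<close>\<close>

definition path_edges :: "'a list \<Rightarrow> 'a set set" where
  "path_edges xs = {{xs ! i, xs ! Suc i} | i. Suc i < length xs}"

lemma path_edges_eq_image: "path_edges xs = (\<lambda>i. {xs ! i, xs ! Suc i}) ` {..<length xs - 1}"
  by (auto simp: path_edges_def)

lemma finite_path_edges: "finite (path_edges xs)"
  by (simp add: path_edges_eq_image)

lemma nth_pair_in_path_edges_iff:
  assumes "distinct xs" "i < length xs" "j < length xs"
  shows "{xs ! i, xs ! j} \<in> path_edges xs \<longleftrightarrow> j = Suc i \<or> i = Suc j"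
  using assms
  by (auto simp: path_edges_def doubleton_eq_iff nth_eq_iff_index_eq insert_commute)

lemma card_path_edges:
  assumes "distinct xs"
  shows "card (path_edges xs) = length xs - 1"
  unfolding path_edges_eq_image
  using assms by (subst card_image) (auto simp: inj_on_def doubleton_eq_iff nth_eq_iff_index_eq)

lemma path_edges_subset:
  assumes "distinct xs"
  shows "path_edges xs \<subseteq> edges (complete_graph (set xs))"
proof
  fix e assume "e \<in> path_edges xs"
  then obtain i where "e = {xs ! i, xs ! Suc i}" "Suc i < length xs"
    by (auto simp: path_edges_def)
  moreover from this have "xs ! i \<noteq> xs ! Suc i"
    using assms by (simp add: nth_eq_iff_index_eq)
  ultimately show "e \<in> edges (complete_graph (set xs))"
    by (force simp: complete_graph_def)
qed

lemma subgraph_complete_graphI: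
  "E \<subseteq> edges (complete_graph X) \<Longrightarrow> subgraph \<lparr>verts = X, edges = E\<rparr> (complete_graph X)"
  unfolding subgraph_def simple_graph_def by (auto simp: complete_graph_def)

section \<open>Edge weights, and membership in the class from characteristic paths and
  cycles\<close>

context Ultrametric_space
begin

lemma edge_weight_pos: "e \<in> edges (complete_graph X) \<Longrightarrow> 0 < edge_weight d e"
  by (auto simp: complete_graph_def edge_weight_eq pos)

lemma edge_weight_in_Sp: "e \<in> edges (complete_graph X) \<Longrightarrow> edge_weight d e \<in> Sp X d"
  unfolding Sp_def by (force simp: complete_graph_def edge_weight_eq)

lemma edge_weight_path:
  assumes "distinct xs" "set xs \<subseteq> X" "Suc i < length xs"
  shows "edge_weight d {xs ! i, xs ! Suc i} = steps d xs ! i"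
  using assms nth_mem[of i xs] nth_mem[of "Suc i" xs]
  by (subst edge_weight_eq) (auto simp: nth_steps nth_eq_iff_index_eq)

lemma inj_on_edge_weight_path:
  assumes "distinct xs" "set xs \<subseteq> X" "distinct (steps d xs)"
  shows "inj_on (edge_weight d) (path_edges xs)"
proof (rule inj_onI)
  fix e e' assume "e \<in> path_edges xs" "e' \<in> path_edges xs" and eq: "edge_weight d e = edge_weight d e'"
  then obtain i j where ij: "e = {xs ! i, xs ! Suc i}" "e' = {xs ! j, xs ! Suc j}"
      "Suc i < length xs" "Suc j < length xs"
    by (auto simp: path_edges_def)
  then have "steps d xs ! i = steps d xs ! j"
    using edge_weight_path assms eq by metis
  then have "i = j"
    using ij assms(3) by (simp add: nth_eq_iff_index_eq)
  then show "e = e'" using ij by simp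
qed

text \<open>The weights on \<open>F\<close> together with 0 are \<open>Suc (card F)\<close>
  different spectrum values, while \<open>card_Sp_le\<close> allows at most \<open>card X\<close>.
  This is the common core of the path and the cycle case.\<close>

lemma in_class_U_if_many_weights:
  assumes "finite X" "X \<noteq> {}" "F \<subseteq> edges (complete_graph X)" "inj_on (edge_weight d) F"
    and "card X \<le> Suc (card F)"
  shows "in_class_U X d"
proof -
  have "finite (Sp X d)" using finite_Sp assms(1) .
  moreover have sub: "edge_weight d ` F \<subseteq> Sp X d"
    using assms(3) edge_weight_in_Sp by auto
  moreover have "0 \<in> Sp X d"
    using assms(2) zero unfolding Sp_def by fastforce
  ultimately have "card (insert 0 (edge_weight d ` F)) \<le> card (Sp X d)"
    by (intro card_mono) auto
  moreover have "0 \<notin> edge_weight d ` F"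
    using assms(3) edge_weight_pos by fastforce
  moreover have "finite (edge_weight d ` F)"
    using finite_subset[OF sub] finite_Sp assms(1) by blast
  ultimately have "Suc (card F) \<le> card (Sp X d)"
    using card_image[OF assms(4)] by simp
  moreover have "card (Sp X d) \<le> card X"
    using card_Sp_le assms Ultrametric_space_axioms by blast
  ultimately show ?thesis
    using assms Ultrametric_space_axioms by (simp add: in_class_U_def)
qed

lemma in_class_U_if_path:
  assumes "finite X" "hamiltonian_path (complete_graph X) P"
    and "characteristic_path P (edge_weight d)"
  shows "in_class_U X d"
proof -
  obtain xs where xs: "xs \<noteq> []" "distinct xs" "verts P = set xs" "edges P = path_edges xs"
    using assms(2) unfolding hamiltonian_path_def is_path_def path_edges_def by blast
  have X: "set xs = X"
    using assms(2) xs by (simp add: hamiltonian_path_def complete_graph_def)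
  then have "card X \<le> Suc (card (edges P))"
    using xs card_path_edges[of xs] distinct_card[of xs] by simp
  then show ?thesis
    using assms X xs(1)
    by (intro in_class_U_if_many_weights[of "edges P"])
      (auto simp: hamiltonian_path_def subgraph_def characteristic_path_def)
qed

text \<open>Dropping one of the two heaviest edges leaves at least \<open>card X - 1\<close> edges
  with pairwise different weights.\<close>

lemma in_class_U_if_cycle:
  assumes "finite X" "hamiltonian_cycle (complete_graph X) C"
    and "characteristic_cycle C (edge_weight d)"
  shows "in_class_U X d"
proof -
  let ?w = "edge_weight d"
  obtain vs where vs: "distinct vs" "set vs = verts C" "3 \<le> card (verts C)"
    and adj: "\<And>i j. i < length vs \<Longrightarrow> j < length vs \<Longrightarrow> {vs ! i, vs ! j} \<in> edges C \<longleftrightarrow>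
      \<bar>int i - int j\<bar> = 1 \<or> \<bar>int i - int j\<bar> = int (length vs) - 1"
    using assms(2) unfolding hamiltonian_cycle_def is_cycle_def by blast
  have X: "verts C = X" and sub: "edges C \<subseteq> edges (complete_graph X)"
    using assms(2) by (auto simp: hamiltonian_cycle_def complete_graph_def subgraph_def)
  have len: "length vs = card X" "3 \<le> length vs"
    using vs X distinct_card[of vs] by auto
  have "finite (edges (complete_graph X))"
    by (rule finite_subset[of _ "Pow X"]) (auto simp: complete_graph_def assms)
  then have fin: "finite (edges C)" using sub finite_subset by blast
  let ?e = "{vs ! 0, vs ! (length vs - 1)}"
  \<comment> \<open>Positions start at 0, so the ends of \<open>vs\<close> differ by
    \<open>length vs - 1\<close>, the second alternative of adjacency. An inclusion suffices because
    only a lower bound on the number of edges is used.\<close>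
  have "insert ?e (path_edges vs) \<subseteq> edges C"
    using adj len by (auto simp: path_edges_def)
  \<comment> \<open>With at least three vertices the two ends are not consecutive, so
    \<open>?e\<close> is one edge more than the \<open>length vs - 1\<close> edges of the
    path.\<close>
  moreover have "?e \<notin> path_edges vs"
    using nth_pair_in_path_edges_iff[OF vs(1), of 0 "length vs - 1"] len by auto
  then have "card (insert ?e (path_edges vs)) = card X"
    using card_path_edges[OF vs(1)] len by (simp add: finite_path_edges)
  ultimately have card: "card X \<le> card (edges C)"
    using card_mono[OF fin] by metis
  obtain e1 e2 where e: "e1 \<noteq> e2" "{e \<in> edges C. ?w e = Max (?w ` edges C)} = {e1, e2}"
      "inj_on ?w (edges C - {e1, e2})"
    using assms(3) unfolding characteristic_cycle_def by auto
  then have e12: "e1 \<in> edges C" "e2 \<in> edges C" and max: "?w e2 = Max (?w ` edges C)"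
    by auto
  \<comment> \<open>The maximum is attained at \<open>e1\<close> and \<open>e2\<close> alone, so
    \<open>e2\<close> can be put back without destroying injectivity.\<close>
  have "?w e \<noteq> ?w e2" if "e \<in> edges C - {e1, e2}" for e
    using that e max by auto
  then have "inj_on ?w (insert e2 (edges C - {e1, e2}))"
    using e(3) by (subst inj_on_insert) force
  moreover have "edges C - {e1} = insert e2 (edges C - {e1, e2})"
    using e e12 by auto
  ultimately have "inj_on ?w (edges C - {e1})" by simp
  moreover have "card X \<le> Suc (card (edges C - {e1}))"
    using card card_Suc_Diff1[OF fin e12(1)] by simp
  moreover have "X \<noteq> {}" using len by auto
  ultimately show ?thesis
    using sub assms(1) by (intro in_class_U_if_many_weights[of "edges C - {e1}"]) auto
qed

section \<open>Construction of characteristic paths and cycles from an enumeration\<close>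

lemma ex_characteristic_path:
  assumes "distinct xs" "xs \<noteq> []" "set xs = X" "distinct (steps d xs)"
  shows "\<exists>P. hamiltonian_path (complete_graph X) P \<and> characteristic_path P (edge_weight d)"
proof -
  let ?P = "\<lparr>verts = X, edges = path_edges xs\<rparr>"
  have sub: "path_edges xs \<subseteq> edges (complete_graph X)"
    using path_edges_subset assms by blast
  have "is_path ?P"
    unfolding is_path_def using assms by (auto simp: path_edges_def intro!: exI[of _ xs])
  moreover have "inj_on (edge_weight d) (path_edges xs)"
    using inj_on_edge_weight_path assms by blast
  ultimately show ?thesis
    using subgraph_complete_graphI[OF sub] edge_weight_pos[OF subsetD[OF sub]]
    unfolding hamiltonian_path_def characteristic_path_def
    by (intro exI[of _ ?P]) (auto simp: complete_graph_def intro: less_imp_le)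
qed

text \<open>The path is closed by the edge \<open>?e\<close> joining its ends. By
  \<open>closing_weight\<close> this edge has the largest path weight, which exactly one path edge
  \<open>?f\<close> attains since the steps are distinct. Away from \<open>?e\<close> and
  \<open>?f\<close> only path edges with different weights remain.\<close>

lemma ex_characteristic_cycle:
  assumes "distinct xs" "3 \<le> length xs" "set xs = X" "distinct (steps d xs)"
  shows "\<exists>C. hamiltonian_cycle (complete_graph X) C \<and> characteristic_cycle C (edge_weight d)"
proof -
  let ?w = "edge_weight d"
  let ?n = "length xs - 1"
  let ?e = "{xs ! 0, xs ! ?n}"
  let ?E = "insert ?e (path_edges xs)"
  let ?C = "\<lparr>verts = X, edges = ?E\<rparr>"
  have "xs ! 0 \<noteq> xs ! ?n"
    using assms(1,2) nth_eq_iff_index_eq[of xs 0 ?n] by (cases xs) auto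
  moreover have in_X: "xs ! 0 \<in> X" "xs ! ?n \<in> X"
    using assms(2) unfolding assms(3)[symmetric] by (auto intro!: nth_mem)
  ultimately have "?e \<in> edges (complete_graph X)"
    by (auto simp: complete_graph_def)
  moreover have pe: "path_edges xs \<subseteq> edges (complete_graph X)"
    using path_edges_subset assms by blast
  ultimately have sub: "?E \<subseteq> edges (complete_graph X)" by simp
  have sg: "subgraph ?C (complete_graph X)"
    using subgraph_complete_graphI[OF sub] .
  have adj: "{xs ! i, xs ! j} \<in> ?E \<longleftrightarrow>
      \<bar>int i - int j\<bar> = 1 \<or> \<bar>int i - int j\<bar> = int (length xs) - 1"
    if "i < length xs" "j < length xs" for i j
  proof -
    have "{xs ! i, xs ! j} = ?e \<longleftrightarrow> i = 0 \<and> j = ?n \<or> i = ?n \<and> j = 0"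
      using that nth_eq_iff_index_eq[OF assms(1)] by (fastforce simp: doubleton_eq_iff)
    \<comment> \<open>A difference of \<open>length xs - 1\<close> between positions occurs only for
      the first and the last one.\<close>
    also have "\<dots> \<longleftrightarrow> \<bar>int i - int j\<bar> = int (length xs) - 1"
      using that assms(2) by linarith
    finally show ?thesis
      using nth_pair_in_path_edges_iff[OF assms(1) that] by auto
  qed
  have "is_cycle ?C"
    unfolding is_cycle_def
    using sg assms(1,2,3) adj distinct_card[OF assms(1)] List.finite_set[of xs]
    by (auto simp: subgraph_def simp del: insert_iff intro!: exI[of _ xs])
  then have ham: "hamiltonian_cycle (complete_graph X) ?C"
    using sg by (simp add: hamiltonian_cycle_def complete_graph_def)
  have inj: "inj_on ?w (path_edges xs)"
    using inj_on_edge_weight_path assms by blast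
  have e_notin: "?e \<notin> path_edges xs"
    using nth_pair_in_path_edges_iff[OF assms(1), of 0 ?n] assms(2) by (cases "xs = []") auto
  have "set (steps d xs) \<noteq> {}"
    using assms(2) length_steps[of d xs] by fastforce
  then have "Max (set (steps d xs)) \<in> set (steps d xs)" by simp
  then obtain i where i: "i < length (steps d xs)" "steps d xs ! i = Max (set (steps d xs))"
    by (auto simp: in_set_conv_nth)
  let ?M = "steps d xs ! i"
  let ?f = "{xs ! i, xs ! Suc i}"
  have "Suc i < length xs" using i by auto
  then have f: "?f \<in> path_edges xs" "?w ?f = ?M"
    using edge_weight_path[OF assms(1), of i] assms(3) by (auto simp: path_edges_def)
  have le: "\<forall>s \<in> set (steps d xs). s \<le> ?M"
    using i by simp
  have "0 < ?M" using f(2) edge_weight_pos[OF subsetD[OF pe f(1)]] by simp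
  then have "d (hd xs) (last xs) = ?M"
    using closing_weight[OF _ i(1) assms(4) le] assms(3) by auto
  moreover have "hd xs = xs ! 0" "last xs = xs ! ?n"
    using assms(2) by (cases "xs = []"; simp add: hd_conv_nth last_conv_nth)+
  ultimately have e: "?w ?e = ?M"
    using edge_weight_eq in_X \<open>xs ! 0 \<noteq> xs ! ?n\<close> by simp
  have path_le: "?w g \<le> ?M" if "g \<in> path_edges xs" for g
    using that le edge_weight_path[OF assms(1)] assms(3) unfolding path_edges_def by force
  have Max: "Max (?w ` ?E) = ?M"
    using path_le e by (intro Max_eqI) (auto simp: finite_path_edges)
  have "g = ?f" if "g \<in> path_edges xs" "?w g = ?M" for g
    using inj_onD[OF inj _ that(1) f(1)] that(2) f(2) by simp
  then have "{g \<in> ?E. ?w g = Max (?w ` ?E)} = {?e, ?f}"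
    unfolding Max using e f by blast
  moreover have "?e \<noteq> ?f" using e_notin f(1) by metis
  moreover have "inj_on ?w (?E - {?e, ?f})"
    by (rule inj_on_subset[OF inj]) auto
  moreover have "0 < ?w g" if "g \<in> ?E" for g
    using subsetD[OF sub that] edge_weight_pos by blast
  then have "\<forall>g \<in> ?E. 0 \<le> ?w g" "\<forall>g \<in> ?E - {?e, ?f}. 0 < ?w g"
    by (blast intro: less_imp_le)+
  ultimately have "characteristic_cycle ?C ?w"
    unfolding characteristic_cycle_def graph.simps
    using \<open>is_cycle ?C\<close> by (intro conjI exI[of _ ?e] exI[of _ ?f])
  with ham show ?thesis by blast
qed

end

theorem theorem2p5:
  fixes X :: "'a set" and d :: "'a \<Rightarrow> 'a \<Rightarrow> real"
  assumes "Ultrametric_space X d"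
    and "finite X"
    and "card X \<ge> 3"
  shows "(in_class_U X d \<longleftrightarrow>
      (\<exists>P. hamiltonian_path (complete_graph X) P \<and> characteristic_path P (edge_weight d)))
    \<and> ((\<exists>P. hamiltonian_path (complete_graph X) P \<and> characteristic_path P (edge_weight d)) \<longleftrightarrow>
      (\<exists>C. hamiltonian_cycle (complete_graph X) C \<and> characteristic_cycle C (edge_weight d)))"
proof -
  interpret Ultrametric_space X d by fact
  have "X \<noteq> {}" using assms(3) by auto
  then have "\<exists>xs. distinct xs \<and> set xs = X \<and> distinct (steps d xs)" if "in_class_U X d"
    using that ex_enumeration_distinct_steps[OF assms(1,2)] by (simp add: in_class_U_def)
  moreover have "xs \<noteq> []" "3 \<le> length xs" if "distinct xs" "set xs = X" for xs
    using that assms(3) distinct_card[of xs] by auto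
  ultimately have
      "in_class_U X d \<Longrightarrow> \<exists>P. hamiltonian_path (complete_graph X) P \<and> characteristic_path P (edge_weight d)"
      "in_class_U X d \<Longrightarrow> \<exists>C. hamiltonian_cycle (complete_graph X) C \<and> characteristic_cycle C (edge_weight d)"
    by (meson ex_characteristic_path ex_characteristic_cycle)+
  \<comment> \<open>The path and the cycle condition are each equivalent to membership in the class,
    hence to each other.\<close>
  then show ?thesis
    using in_class_U_if_path[OF assms(2)] in_class_U_if_cycle[OF assms(2)] by blast
qed

end
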